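(* Let $G=(V,E)$ be a finite graph, $\beta>0$, $\pmb{J}=(J_{ij})\in[0,\infty)^E$, $p_{ij}=1-\exp(-2\beta J_{ij})$ and $\pmb{h}=(h_i)\in\mathbb{R}^V$. For any fixed $x\in V$, $$\lambda_{\beta,\pmb{h},V}(\sigma_x=\pm1)=\frac12\pm\frac12\,\phi_{\pmb{p},\pmb{h},G}\big(\tanh(\pmb{h}(K_t))\big),$$ where $K_t=K_t(\omega)$ is the open connected component containing $x$.
   Context: Ising measure with free boundary condition: $\lambda_{\beta,\pmb{h},V}(\sigma)\propto\exp\big(\beta\sum_{\{i,j\}\in E}J_{ij}\sigma_i\sigma_j+\beta\sum_{i\in V}h_i\sigma_i\big)$ on $\{-1,+1\}^V$, normalized to be a probability. For $\omega\in\{0,1\}^E$, $\eta(\omega)=\{e:\omega_e=1\}$ is the set of open edges; $K_1,\dots,K_{k(\omega,G)}$ are the (vertex sets of the) connected components of $(V,\eta(\omega))$; $\pmb{h}(K)=\beta\sum_{i\in K}h_i$; and $B_{\pmb{J}}(\omega)=\prod_{\{i,j\}:\omega_{ij}=1}p_{ij}\prod_{\{i,j\}:\omega_{ij}=0}(1-p_{ij})$. The random-cluster measure is $\phi_{\pmb{p},\pmb{h},G}(\omega)\propto B_{\pmb{J}}(\omega)\prod_{\alpha=1}^{k(\omega,G)}2\cosh(\pmb{h}(K_\alpha))$, normalized to be a probability on $\{0,1\}^E$. $\phi(f)$ denotes the expectation of $f$ under $\phi$. *)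

theory Defs
  imports "HOL-Probability.Probability"
begin

text \<open>Graphs are simple: an edge is a two-element set of vertices.\<close>

definition finite_graph :: "'v set \<Rightarrow> 'v set set \<Rightarrow> bool" where
  "finite_graph V E \<longleftrightarrow> finite V \<and> (\<forall>e\<in>E. e \<subseteq> V \<and> card e = 2)"

definition normalized_measure :: "'a set \<Rightarrow> ('a \<Rightarrow> real) \<Rightarrow> 'a measure" where
  "normalized_measure A w = point_measure A (\<lambda>a. ennreal (w a / (\<Sum>b\<in>A. w b)))"

lemma prob_space_normalized_measure:
  assumes "finite A" "\<And>a. a \<in> A \<Longrightarrow> 0 \<le> w a" "0 < (\<Sum>a\<in>A. w a)"
  shows "prob_space (normalized_measure A w)"
proof
  have "emeasure (normalized_measure A w) A = (\<Sum>a\<in>A. ennreal (w a / (\<Sum>b\<in>A. w b)))"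
    unfolding normalized_measure_def using assms by (simp add: emeasure_point_measure_finite)
  also have "\<dots> = ennreal (\<Sum>a\<in>A. w a / (\<Sum>b\<in>A. w b))"
    using assms by (intro sum_ennreal) auto
  also have "(\<Sum>a\<in>A. w a / (\<Sum>b\<in>A. w b)) = 1"
    using assms by (simp flip: sum_divide_distrib)
  finally show "emeasure (normalized_measure A w) (space (normalized_measure A w)) = 1"
    by (simp add: normalized_measure_def space_point_measure)
qed


subsection \<open>The Ising measure with free boundary condition\<close>

text \<open>Since an edge \<open>e = {i, j}\<close> has exactly two elements, \<open>\<Prod>i\<in>e. \<sigma> i\<close> is
  \<open>\<sigma> i * \<sigma> j\<close>.\<close>

definition ising_weight ::
  "real \<Rightarrow> ('v set \<Rightarrow> real) \<Rightarrow> ('v \<Rightarrow> real) \<Rightarrow> 'v set \<Rightarrow> 'v set set \<Rightarrow> ('v \<Rightarrow> real) \<Rightarrow> real" where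
  "ising_weight \<beta> J h V E \<sigma> =
     exp (\<beta> * (\<Sum>e\<in>E. J e * (\<Prod>i\<in>e. \<sigma> i)) + \<beta> * (\<Sum>i\<in>V. h i * \<sigma> i))"

definition ising_measure ::
  "real \<Rightarrow> ('v set \<Rightarrow> real) \<Rightarrow> ('v \<Rightarrow> real) \<Rightarrow> 'v set \<Rightarrow> 'v set set \<Rightarrow> ('v \<Rightarrow> real) measure" where
  "ising_measure \<beta> J h V E =
     normalized_measure (V \<rightarrow>\<^sub>E {-1, 1}) (ising_weight \<beta> J h V E)"


subsection \<open>The random-cluster measure\<close>

definition open_edges :: "'v set set \<Rightarrow> ('v set \<Rightarrow> nat) \<Rightarrow> 'v set set" where
  "open_edges E \<omega> = {e\<in>E. \<omega> e = 1}"

definition connection :: "'v set \<Rightarrow> 'v set set \<Rightarrow> ('v \<times> 'v) set" where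
  "connection V F = {(i, j). i \<in> V \<and> j \<in> V \<and> (i, j) \<in> {(u, v). {u, v} \<in> F}\<^sup>*}"

text \<open>Clusters are the (vertex sets of the) connected components of the graph \<open>(V, F)\<close>.\<close>

definition clusters :: "'v set \<Rightarrow> 'v set set \<Rightarrow> 'v set set" where
  "clusters V F = V // connection V F"

definition cluster_of :: "'v set \<Rightarrow> 'v set set \<Rightarrow> 'v \<Rightarrow> 'v set" where
  "cluster_of V F x = connection V F `` {x}"

lemma equiv_connection: "equiv V (connection V F)"
proof (rule equivI)
  show "connection V F \<subseteq> V \<times> V" "refl_on V (connection V F)"
    by (auto simp: connection_def refl_on_def)
  have "sym ({(u, v). {u, v} \<in> F}\<^sup>*)"
    by (intro sym_rtrancl) (auto simp: sym_def insert_commute)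
  then show "sym (connection V F)"
    by (auto simp: connection_def sym_def)
  show "trans (connection V F)"
    by (auto simp: connection_def trans_def)
qed

lemma cluster_of_unique:
  assumes "x \<in> V"
  shows "K \<in> clusters V F \<and> x \<in> K \<longleftrightarrow> K = cluster_of V F x"
proof
  assume K: "K \<in> clusters V F \<and> x \<in> K"
  then obtain y where y: "K = connection V F `` {y}"
    by (auto simp: clusters_def quotient_def)
  with K have "(y, x) \<in> connection V F"
    by simp
  with y show "K = cluster_of V F x"
    unfolding cluster_of_def by (simp add: equiv_class_eq[OF equiv_connection])
next
  assume "K = cluster_of V F x"
  with assms show "K \<in> clusters V F \<and> x \<in> K"
    using equiv_class_self[OF equiv_connection]
    by (auto simp: cluster_of_def clusters_def intro: quotientI)
qed

definition cluster_field :: "real \<Rightarrow> ('v \<Rightarrow> real) \<Rightarrow> 'v set \<Rightarrow> real" where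
  "cluster_field \<beta> h K = \<beta> * (\<Sum>i\<in>K. h i)"

definition bernoulli_weight :: "('v set \<Rightarrow> real) \<Rightarrow> 'v set set \<Rightarrow> ('v set \<Rightarrow> nat) \<Rightarrow> real" where
  "bernoulli_weight p E \<omega> = (\<Prod>e\<in>{e\<in>E. \<omega> e = 1}. p e) * (\<Prod>e\<in>{e\<in>E. \<omega> e = 0}. 1 - p e)"

definition rc_weight ::
  "real \<Rightarrow> ('v set \<Rightarrow> real) \<Rightarrow> ('v \<Rightarrow> real) \<Rightarrow> 'v set \<Rightarrow> 'v set set \<Rightarrow> ('v set \<Rightarrow> nat) \<Rightarrow> real" where
  "rc_weight \<beta> p h V E \<omega> =
     bernoulli_weight p E \<omega> *
     (\<Prod>K\<in>clusters V (open_edges E \<omega>). 2 * cosh (cluster_field \<beta> h K))"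

definition rc_measure ::
  "real \<Rightarrow> ('v set \<Rightarrow> real) \<Rightarrow> ('v \<Rightarrow> real) \<Rightarrow> 'v set \<Rightarrow> 'v set set \<Rightarrow> ('v set \<Rightarrow> nat) measure" where
  "rc_measure \<beta> p h V E = normalized_measure (E \<rightarrow>\<^sub>E {0, 1}) (rc_weight \<beta> p h V E)"

end

theory Submission
  imports Defs
begin

text \<open>
  The theorem is the Edwards--Sokal coupling, read off from two partial sums of one joint weight.
  Up to the constant \<open>exp (\<beta> * (\<Sum>e\<in>E. J e))\<close>, an edge contributes to the Ising weight the factor
  \<open>1\<close> if its end points agree and \<open>exp (-2 * \<beta> * J e) = 1 - p e\<close> if they disagree, that is
  \<open>p e * [the end points agree] + (1 - p e)\<close>. Expanding the product over the edges attaches to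
  each spin configuration \<open>\<sigma>\<close> a sum over edge configurations \<open>\<omega>\<close> in which every open edge of \<open>\<omega>\<close>
  forces its end points to agree (lemma \<open>ising_weight_expansion\<close>).

  Now sum over \<open>\<sigma>\<close> first, with \<open>\<omega>\<close> fixed. The admissible \<open>\<sigma>\<close> are those constant on the clusters of
  \<open>\<omega>\<close>, hence they are free choices of one sign per cluster, and the external field factorizes:
  a cluster \<open>K\<close> of sign \<open>s\<close> has weight \<open>exp (s * cluster_field \<beta> h K)\<close>. Thus each cluster
  contributes its two-point sum \<open>2 * cosh (cluster_field \<beta> h K)\<close>, which gives the random-cluster
  weight. If a function \<open>g (\<sigma> x)\<close> of the spin at \<open>x\<close> is inserted, only the factor of the
  cluster containing \<open>x\<close> changes (lemma \<open>ising_sum_eq_random_cluster_sum\<close>): that factor is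
  multiplied by the mean of \<open>g\<close> under the law of the sign of this cluster. For the identity
  function this mean is the hyperbolic tangent of the field of the cluster, so the expected spin
  at \<open>x\<close> is the random-cluster expectation of that tangent. A random sign is \<open>\<pm>1\<close> with
  probability \<open>1/2\<close> plus or minus half its expectation, and the theorem follows.
\<close>

section \<open>Finite probability spaces given by weights\<close>

lemma integral_normalized_measure:
  fixes f :: "'a \<Rightarrow> real"
  assumes "finite A" "\<And>a. a \<in> A \<Longrightarrow> 0 \<le> w a"
  shows "(\<integral>a. f a \<partial>normalized_measure A w) = (\<Sum>a\<in>A. w a * f a) / (\<Sum>a\<in>A. w a)"
  unfolding normalized_measure_def using assms
  by (subst lebesgue_integral_point_measure_finite)
     (auto simp: sum_nonneg sum_divide_distrib intro!: sum.cong)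

lemma prob_sign_eq_half_plus_expectation:
  fixes X :: "'a \<Rightarrow> real" and s :: real
  assumes "finite A" "\<And>a. a \<in> A \<Longrightarrow> 0 \<le> w a" "0 < (\<Sum>a\<in>A. w a)"
    and X: "\<And>a. a \<in> A \<Longrightarrow> X a \<in> {-1, 1}" and s: "s \<in> {-1, 1}"
  shows "\<P>(a in normalized_measure A w. X a = s) =
           1 / 2 + s / 2 * ((\<Sum>a\<in>A. w a * X a) / (\<Sum>a\<in>A. w a))"
proof -
  let ?M = "normalized_measure A w"
  have space: "space ?M = A" and sets: "sets ?M = Pow A"
    by (simp_all add: normalized_measure_def space_point_measure sets_point_measure)
  have "\<P>(a in ?M. X a = s) = (\<integral>a. indicator {a \<in> space ?M. X a = s} a \<partial>?M)"
    by (simp add: Int_absorb2)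
  also have "\<dots> = (\<Sum>a\<in>A. w a * indicator {a \<in> space ?M. X a = s} a) / (\<Sum>a\<in>A. w a)"
    using assms by (intro integral_normalized_measure) auto
  \<comment> \<open>On signs, the indicator of \<open>X a = s\<close> is the affine function \<open>(1 + s * X a) / 2\<close>.\<close>
  also have "(\<Sum>a\<in>A. w a * indicator {a \<in> space ?M. X a = s} a) =
             (\<Sum>a\<in>A. w a / 2 + s / 2 * (w a * X a))"
    using X s by (intro sum.cong refl) (force simp: space indicator_def)
  also have "\<dots> = (\<Sum>a\<in>A. w a) / 2 + s / 2 * (\<Sum>a\<in>A. w a * X a)"
    by (simp add: sum.distrib sum_divide_distrib sum_distrib_left)
  finally show ?thesis
    using assms(3) by (simp add: add_divide_distrib)
qed

lemma exp_sum_eq_cosh: "exp k + exp (- k) = 2 * cosh k" "exp (- k) + exp k = 2 * cosh k"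
  for k :: real
  by (simp_all add: cosh_def)

lemma exp_diff_div_cosh: "(exp k - exp (- k)) / (2 * cosh k) = tanh k" for k :: real
  by (simp add: tanh_def sinh_def)

section \<open>Functions that are constant on the classes of an equivalence relation\<close>

lemma sum_over_classes:
  fixes f :: "'v \<Rightarrow> real"
  assumes "equiv V r" "finite V"
  shows "(\<Sum>i\<in>V. f i) = (\<Sum>K\<in>V // r. \<Sum>i\<in>K. f i)"
proof -
  have "sum f (\<Union>(V // r)) = (sum \<circ> sum) f (V // r)"
  proof (rule sum.Union_disjoint)
    show "\<forall>A\<in>V // r. finite A"
      using in_quotient_imp_subset[OF assms(1)] finite_subset[OF _ assms(2)] by blast
    show "\<forall>A\<in>V // r. \<forall>B\<in>V // r. A \<noteq> B \<longrightarrow> A \<inter> B = {}"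
      using quotient_disj[OF assms(1)] by blast
  qed
  then show ?thesis
    by (simp add: Union_quotient[OF assms(1)])
qed

text \<open>
  A function that respects the relation is the same thing as a function on the quotient. This turns
  a sum over constrained configurations into one over a full function space, which is what allows
  it to be factorized.
\<close>

lemma sum_class_constant_functions:
  fixes G :: "('v \<Rightarrow> 'b) \<Rightarrow> real"
  assumes r: "equiv V r"
  shows "(\<Sum>\<sigma>\<in>{\<sigma> \<in> V \<rightarrow>\<^sub>E S. \<forall>(i, j)\<in>r. \<sigma> i = \<sigma> j}. G \<sigma>) =
         (\<Sum>\<tau>\<in>(V // r \<rightarrow>\<^sub>E S). G (\<lambda>i\<in>V. \<tau> (r `` {i})))"
proof (rule sum.reindex_bij_betw[symmetric])
  let ?lift = "\<lambda>\<tau>. \<lambda>i\<in>V. \<tau> (r `` {i})"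
  have rV: "r \<subseteq> V \<times> V"
    using r by (simp add: equiv_def)
  show "bij_betw ?lift (V // r \<rightarrow>\<^sub>E S) {\<sigma> \<in> V \<rightarrow>\<^sub>E S. \<forall>(i, j)\<in>r. \<sigma> i = \<sigma> j}"
  proof (rule bij_betw_imageI)
    show "inj_on ?lift (V // r \<rightarrow>\<^sub>E S)"
    proof (rule inj_onI)
      fix \<tau> \<tau>' assume \<tau>: "\<tau> \<in> V // r \<rightarrow>\<^sub>E S" and \<tau>': "\<tau>' \<in> V // r \<rightarrow>\<^sub>E S"
        and eq: "?lift \<tau> = ?lift \<tau>'"
      show "\<tau> = \<tau>'"
      proof (rule PiE_ext[OF \<tau> \<tau>'])
        fix K assume "K \<in> V // r"
        then obtain i where i: "i \<in> V" "K = r `` {i}"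
          by (auto elim: quotientE)
        then show "\<tau> K = \<tau>' K"
          using fun_cong[OF eq, of i] by simp
      qed
    qed
    show "?lift ` (V // r \<rightarrow>\<^sub>E S) = {\<sigma> \<in> V \<rightarrow>\<^sub>E S. \<forall>(i, j)\<in>r. \<sigma> i = \<sigma> j}" (is "_ = ?R")
    proof (intro equalityI subsetI)
      fix \<sigma> assume "\<sigma> \<in> ?lift ` (V // r \<rightarrow>\<^sub>E S)"
      then obtain \<tau> where \<tau>: "\<tau> \<in> V // r \<rightarrow>\<^sub>E S" and \<sigma>: "\<sigma> = ?lift \<tau>"
        by blast
      have "\<sigma> \<in> V \<rightarrow>\<^sub>E S"
        using \<tau> by (auto simp: \<sigma> intro: quotientI)
      moreover have "\<sigma> i = \<sigma> j" if "(i, j) \<in> r" for i j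
      proof -
        have "i \<in> V" "j \<in> V"
          using that rV by auto
        then show ?thesis
          using equiv_class_eq[OF r that] by (simp add: \<sigma>)
      qed
      ultimately show "\<sigma> \<in> ?R"
        by auto
    next
      fix \<sigma> assume "\<sigma> \<in> ?R"
      then have \<sigma>: "\<sigma> \<in> V \<rightarrow>\<^sub>E S" and const: "\<And>i j. (i, j) \<in> r \<Longrightarrow> \<sigma> i = \<sigma> j"
        by auto
      define \<tau> where "\<tau> = (\<lambda>K\<in>V // r. \<sigma> (SOME i. i \<in> K))"
      have rep: "(i, SOME j. j \<in> r `` {i}) \<in> r" if "i \<in> V" for i
        using someI[of "\<lambda>j. j \<in> r `` {i}", OF equiv_class_self[OF r that]] by blast
      have \<tau>_class: "\<tau> (r `` {i}) = \<sigma> i" if "i \<in> V" for i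
        using const[OF rep[OF that]] that by (simp add: \<tau>_def quotientI)
      have "\<tau> \<in> V // r \<rightarrow>\<^sub>E S"
      proof (rule PiE_I)
        fix K assume "K \<in> V // r"
        then obtain i where i: "i \<in> V" "K = r `` {i}"
          by (auto elim: quotientE)
        then show "\<tau> K \<in> S"
          using \<tau>_class[OF i(1)] \<sigma> by auto
      qed (simp add: \<tau>_def)
      moreover have "\<sigma> = ?lift \<tau>"
      proof
        fix i show "\<sigma> i = ?lift \<tau> i"
          using \<tau>_class[of i] PiE_arb[OF \<sigma>, of i] by (cases "i \<in> V") simp_all
      qed
      ultimately show "\<sigma> \<in> ?lift ` (V // r \<rightarrow>\<^sub>E S)"
        by blast
    qed
  qed
qed

section \<open>The joint weight of spins and edges\<close>

lemma agree_on_open_edges_iff_constant_on_clusters: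
  assumes G: "finite_graph V F" and \<sigma>: "\<sigma> \<in> V \<rightarrow>\<^sub>E {-1, 1 :: real}"
  shows "(\<forall>e\<in>F. (\<Prod>i\<in>e. \<sigma> i) = 1) \<longleftrightarrow> (\<forall>(i, j)\<in>connection V F. \<sigma> i = \<sigma> j)"
proof
  assume agree: "\<forall>e\<in>F. (\<Prod>i\<in>e. \<sigma> i) = 1"
  have step: "\<sigma> u = \<sigma> v" if "{u, v} \<in> F" for u v
  proof -
    have "{u, v} \<subseteq> V" "card {u, v} = 2"
      using G that unfolding finite_graph_def by blast+
    then have "\<sigma> u \<in> {-1, 1}" "\<sigma> v \<in> {-1, 1}" "u \<noteq> v"
      using \<sigma> by auto
    then show ?thesis
      using agree that by fastforce
  qed
  have "\<sigma> i = \<sigma> j" if "(i, j) \<in> {(u, v). {u, v} \<in> F}\<^sup>*" for i j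
    using that by induction (auto dest: step)
  then show "\<forall>(i, j)\<in>connection V F. \<sigma> i = \<sigma> j"
    by (auto simp: connection_def)
next
  assume const: "\<forall>(i, j)\<in>connection V F. \<sigma> i = \<sigma> j"
  show "\<forall>e\<in>F. (\<Prod>i\<in>e. \<sigma> i) = 1"
  proof
    fix e assume e: "e \<in> F"
    then have "e \<subseteq> V" "card e = 2"
      using G unfolding finite_graph_def by blast+
    then obtain u v where uv: "e = {u, v}" "u \<noteq> v" "u \<in> V" "v \<in> V"
      by (auto simp: card_2_iff)
    with e have "(u, v) \<in> connection V F"
      by (auto simp: connection_def)
    with const have "\<sigma> u = \<sigma> v"
      by auto
    moreover have "\<sigma> v \<in> {-1, 1}"
      using \<sigma> uv by auto
    ultimately show "(\<Prod>i\<in>e. \<sigma> i) = 1"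
      using uv by auto
  qed
qed

lemma bernoulli_weight_eq_prod:
  assumes "finite E" "\<omega> \<in> E \<rightarrow>\<^sub>E {0, 1}"
  shows "bernoulli_weight p E \<omega> = (\<Prod>e\<in>E. if \<omega> e = 1 then p e else 1 - p e)"
proof -
  have "{e \<in> E. \<omega> e = 0} = {e \<in> E. \<omega> e \<noteq> 1}"
    using assms(2) by fastforce
  then show ?thesis
    using assms(1) by (simp add: bernoulli_weight_def prod.If_cases Int_def)
qed

text \<open>
  The summand on the right, without the constant, is the Edwards--Sokal joint weight of \<open>\<sigma>\<close> and
  \<open>\<omega>\<close>. The sum over \<open>\<omega>\<close> comes from multiplying out, over all edges, the two terms in
  \<open>exp (\<beta> * J e * s) = exp (\<beta> * J e) * ((1 - p e) + p e * [s = 1])\<close>, where \<open>s \<in> {-1, 1}\<close> is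
  the product of the spins at the end points of \<open>e\<close>.
\<close>

lemma ising_weight_expansion:
  assumes G: "finite_graph V E" and p: "\<And>e. e \<in> E \<Longrightarrow> p e = 1 - exp (- 2 * \<beta> * J e)"
    and \<sigma>: "\<sigma> \<in> V \<rightarrow>\<^sub>E {-1, 1}"
  shows "ising_weight \<beta> J h V E \<sigma> = exp (\<beta> * (\<Sum>e\<in>E. J e)) *
           (\<Sum>\<omega>\<in>(E \<rightarrow>\<^sub>E {0, 1}). bernoulli_weight p E \<omega> *
              of_bool (\<forall>(i, j)\<in>connection V (open_edges E \<omega>). \<sigma> i = \<sigma> j) *
              exp (\<beta> * (\<Sum>i\<in>V. h i * \<sigma> i)))"
proof -
  let ?s = "\<lambda>e. \<Prod>i\<in>e. \<sigma> i"
  define t where "t e k = (if k = (1 :: nat) then p e * of_bool (?s e = 1) else 1 - p e)" for e k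
  have fin: "finite E"
    using G by (auto simp: finite_graph_def intro: finite_subset[of _ "Pow V"])
  have sign: "?s e \<in> {-1, 1}" if "e \<in> E" for e
  proof -
    have "e \<subseteq> V" "card e = 2"
      using G that unfolding finite_graph_def by blast+
    then obtain u v where uv: "e = {u, v}" "u \<noteq> v" "u \<in> V" "v \<in> V"
      by (auto simp: card_2_iff)
    then have "\<sigma> u \<in> {-1, 1}" "\<sigma> v \<in> {-1, 1}"
      using \<sigma> by auto
    then show ?thesis
      using uv by auto
  qed
  have edge: "exp (\<beta> * (J e * ?s e)) = exp (\<beta> * J e) * (\<Sum>k\<in>{0, 1}. t e k)" if "e \<in> E" for e
    using sign[OF that] by (auto simp: t_def p[OF that] simp flip: exp_add)
  have joint: "(\<Prod>e\<in>E. t e (\<omega> e)) = bernoulli_weight p E \<omega> *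
      of_bool (\<forall>(i, j)\<in>connection V (open_edges E \<omega>). \<sigma> i = \<sigma> j)"
    if \<omega>: "\<omega> \<in> E \<rightarrow>\<^sub>E {0, 1}" for \<omega>
  proof -
    have "(\<Prod>e\<in>E. t e (\<omega> e)) = (\<Prod>e\<in>E. if \<omega> e = 1 then p e else 1 - p e) *
        (\<Prod>e\<in>E. of_bool (e \<in> open_edges E \<omega> \<longrightarrow> ?s e = 1))"
      unfolding prod.distrib[symmetric]
      by (intro prod.cong refl) (auto simp: t_def open_edges_def)
    also have "(\<Prod>e\<in>E. of_bool (e \<in> open_edges E \<omega> \<longrightarrow> ?s e = 1) :: real) =
        of_bool (\<forall>e\<in>open_edges E \<omega>. ?s e = 1)"
    proof (cases "\<forall>e\<in>open_edges E \<omega>. ?s e = 1")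
      case False
      then obtain e where "e \<in> open_edges E \<omega>" "?s e \<noteq> 1"
        by blast
      then have "\<exists>e\<in>E. of_bool (e \<in> open_edges E \<omega> \<longrightarrow> ?s e = 1) = (0 :: real)"
        by (auto simp: open_edges_def)
      then have "(\<Prod>e\<in>E. of_bool (e \<in> open_edges E \<omega> \<longrightarrow> ?s e = 1)) = (0 :: real)"
        by (rule prod_zero[OF fin])
      then show ?thesis
        using False by simp
    qed simp
    also have "(\<forall>e\<in>open_edges E \<omega>. ?s e = 1) \<longleftrightarrow>
        (\<forall>(i, j)\<in>connection V (open_edges E \<omega>). \<sigma> i = \<sigma> j)"
      using G by (intro agree_on_open_edges_iff_constant_on_clusters \<sigma>)
        (auto simp: finite_graph_def open_edges_def)
    finally show ?thesis
      by (simp add: bernoulli_weight_eq_prod[OF fin \<omega>])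
  qed
  have "exp (\<beta> * (\<Sum>e\<in>E. J e * ?s e)) = (\<Prod>e\<in>E. exp (\<beta> * J e) * (\<Sum>k\<in>{0, 1}. t e k))"
    unfolding sum_distrib_left[of \<beta>] exp_sum[OF fin] by (intro prod.cong refl edge)
  also have "\<dots> = exp (\<beta> * (\<Sum>e\<in>E. J e)) * (\<Prod>e\<in>E. \<Sum>k\<in>{0, 1}. t e k)"
    by (simp only: prod.distrib sum_distrib_left[of \<beta>] exp_sum[OF fin])
  also have "(\<Prod>e\<in>E. \<Sum>k\<in>{0, 1}. t e k) = (\<Sum>\<omega>\<in>(E \<rightarrow>\<^sub>E {0, 1}). \<Prod>e\<in>E. t e (\<omega> e))"
    using fin by (intro prod_sum_PiE) auto
  also have "\<dots> = (\<Sum>\<omega>\<in>(E \<rightarrow>\<^sub>E {0, 1}). bernoulli_weight p E \<omega> *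
      of_bool (\<forall>(i, j)\<in>connection V (open_edges E \<omega>). \<sigma> i = \<sigma> j))"
    by (intro sum.cong refl joint)
  finally show ?thesis
    by (simp add: ising_weight_def exp_add sum_distrib_right mult.assoc)
qed

text \<open>
  With the open edges fixed, the clusters carry independent signs. The quotient on the right is
  the mean of \<open>g\<close> under the law of the sign of the cluster containing \<open>x\<close>. It appears because the insertion of
  \<open>g (\<sigma> x)\<close> replaces the factor \<open>2 * cosh k\<close> of that cluster, with field \<open>k\<close>, by
  \<open>g 1 * exp k + g (-1) * exp (-k)\<close>.
\<close>

lemma sum_over_cluster_signs:
  fixes g :: "real \<Rightarrow> real" and \<beta> :: real and h :: "'v \<Rightarrow> real"
    and V :: "'v set" and F :: "'v set set"
  assumes "finite V" and x: "x \<in> V"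
  defines "k \<equiv> cluster_field \<beta> h (cluster_of V F x)"
  shows "(\<Sum>\<sigma>\<in>{\<sigma> \<in> V \<rightarrow>\<^sub>E {-1, 1}. \<forall>(i, j)\<in>connection V F. \<sigma> i = \<sigma> j}.
            g (\<sigma> x) * exp (\<beta> * (\<Sum>i\<in>V. h i * \<sigma> i))) =
         (\<Prod>K\<in>clusters V F. 2 * cosh (cluster_field \<beta> h K)) *
           ((g 1 * exp k + g (-1) * exp (-k)) / (2 * cosh k))"
proof -
  let ?r = "connection V F" and ?C = "cluster_of V F x"
  note r = equiv_connection[of V F]
  define u where "u K s = (if K = ?C then g s else 1) * exp (s * cluster_field \<beta> h K)" for K s
  have fin: "finite (clusters V F)"
    unfolding clusters_def using assms(1) r
    by (intro finite_quotient) (auto simp: connection_def)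
  have C: "?C \<in> clusters V F"
    using cluster_of_unique[OF x] by blast
  have field: "\<beta> * (\<Sum>i\<in>V. h i * (\<lambda>i\<in>V. \<tau> (?r `` {i})) i) =
      (\<Sum>K\<in>clusters V F. \<tau> K * cluster_field \<beta> h K)" for \<tau> :: "'v set \<Rightarrow> real"
  proof -
    have "(\<Sum>i\<in>K. h i * (\<lambda>i\<in>V. \<tau> (?r `` {i})) i) = \<tau> K * (\<Sum>i\<in>K. h i)"
      if K: "K \<in> V // ?r" for K
      unfolding sum_distrib_left
    proof (intro sum.cong refl)
      fix i assume i: "i \<in> K"
      have "i \<in> V"
        using K i Union_quotient[OF r] by blast
      moreover have "?r `` {i} = K"
        using cluster_of_unique[OF \<open>i \<in> V\<close>, of K F] K i by (simp add: cluster_of_def clusters_def)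
      ultimately show "h i * (\<lambda>i\<in>V. \<tau> (?r `` {i})) i = \<tau> K * h i"
        by simp
    qed
    then have "(\<Sum>i\<in>V. h i * (\<lambda>i\<in>V. \<tau> (?r `` {i})) i) = (\<Sum>K\<in>V // ?r. \<tau> K * (\<Sum>i\<in>K. h i))"
      unfolding sum_over_classes[OF r assms(1)] by (intro sum.cong refl)
    then show ?thesis
      by (simp only: clusters_def cluster_field_def sum_distrib_left[of \<beta> _ "V // ?r"]
          mult.left_commute)
  qed
  have "(\<Sum>\<sigma>\<in>{\<sigma> \<in> V \<rightarrow>\<^sub>E {-1, 1}. \<forall>(i, j)\<in>?r. \<sigma> i = \<sigma> j}.
            g (\<sigma> x) * exp (\<beta> * (\<Sum>i\<in>V. h i * \<sigma> i))) =
        (\<Sum>\<tau>\<in>(clusters V F \<rightarrow>\<^sub>E {-1, 1}).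
            g (\<tau> ?C) * exp (\<Sum>K\<in>clusters V F. \<tau> K * cluster_field \<beta> h K))"
  proof -
    have "?C = ?r `` {x}"
      by (simp add: cluster_of_def)
    with x show ?thesis
      unfolding sum_class_constant_functions[OF r] clusters_def[symmetric]
      by (intro sum.cong refl arg_cong2[where f = "(*)"] arg_cong[where f = exp] field) simp
  qed
  also have "\<dots> = (\<Sum>\<tau>\<in>(clusters V F \<rightarrow>\<^sub>E {-1, 1}). \<Prod>K\<in>clusters V F. u K (\<tau> K))"
    using fin C by (simp add: u_def prod.distrib exp_sum prod.delta)
  also have "\<dots> = (\<Prod>K\<in>clusters V F. \<Sum>s\<in>{-1, 1}. u K s)"
    using fin by (intro prod_sum_PiE[symmetric]) auto
  also have "\<dots> = (\<Sum>s\<in>{-1, 1}. u ?C s) * (\<Prod>K\<in>clusters V F - {?C}. \<Sum>s\<in>{-1, 1}. u K s)"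
    by (rule prod.remove[OF fin C])
  also have "(\<Sum>s\<in>{-1, 1}. u ?C s) = g 1 * exp k + g (-1) * exp (-k)"
    by (simp add: u_def k_def)
  also have "(\<Prod>K\<in>clusters V F - {?C}. \<Sum>s\<in>{-1, 1}. u K s) =
      (\<Prod>K\<in>clusters V F - {?C}. 2 * cosh (cluster_field \<beta> h K))"
    by (intro prod.cong refl) (auto simp: u_def exp_sum_eq_cosh)
  also have "(g 1 * exp k + g (-1) * exp (-k)) * \<dots> =
      (2 * cosh k * (\<Prod>K\<in>clusters V F - {?C}. 2 * cosh (cluster_field \<beta> h K))) *
      ((g 1 * exp k + g (-1) * exp (-k)) / (2 * cosh k))"
    by simp
  also have "2 * cosh k * (\<Prod>K\<in>clusters V F - {?C}. 2 * cosh (cluster_field \<beta> h K)) =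
      (\<Prod>K\<in>clusters V F. 2 * cosh (cluster_field \<beta> h K))"
    unfolding k_def by (rule prod.remove[OF fin C, symmetric])
  finally show ?thesis .
qed

text \<open>
  Exchanging the two summations of the joint weight gives unnormalized Ising expectations on the
  left and random-cluster ones on the right. Both instances of \<open>g\<close> matter: the constant \<open>1\<close>
  compares the partition functions, and the identity compares the numerators of the mean spin.
  The common constant then cancels.
\<close>

lemma ising_sum_eq_random_cluster_sum:
  fixes g :: "real \<Rightarrow> real" and \<beta> :: real and J p :: "'v set \<Rightarrow> real" and h :: "'v \<Rightarrow> real"
    and V :: "'v set" and E :: "'v set set"
  assumes G: "finite_graph V E" and p: "\<And>e. e \<in> E \<Longrightarrow> p e = 1 - exp (- 2 * \<beta> * J e)"
    and x: "x \<in> V"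
  defines "k \<equiv> \<lambda>\<omega>. cluster_field \<beta> h (cluster_of V (open_edges E \<omega>) x)"
  shows "(\<Sum>\<sigma>\<in>(V \<rightarrow>\<^sub>E {-1, 1}). ising_weight \<beta> J h V E \<sigma> * g (\<sigma> x)) =
         exp (\<beta> * (\<Sum>e\<in>E. J e)) * (\<Sum>\<omega>\<in>(E \<rightarrow>\<^sub>E {0, 1}). rc_weight \<beta> p h V E \<omega> *
            ((g 1 * exp (k \<omega>) + g (-1) * exp (- k \<omega>)) / (2 * cosh (k \<omega>))))"
proof -
  let ?c = "exp (\<beta> * (\<Sum>e\<in>E. J e))" and ?S = "V \<rightarrow>\<^sub>E {-1, 1 :: real}"
  let ?ok = "\<lambda>\<omega> \<sigma> :: 'v \<Rightarrow> real. \<forall>(i, j)\<in>connection V (open_edges E \<omega>). \<sigma> i = \<sigma> j"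
  let ?f = "\<lambda>\<sigma>. g (\<sigma> x) * exp (\<beta> * (\<Sum>i\<in>V. h i * \<sigma> i))"
  have fin: "finite V"
    using G by (simp add: finite_graph_def)
  have "(\<Sum>\<sigma>\<in>?S. ising_weight \<beta> J h V E \<sigma> * g (\<sigma> x)) =
        (\<Sum>\<sigma>\<in>?S. ?c * (\<Sum>\<omega>\<in>(E \<rightarrow>\<^sub>E {0, 1}).
            bernoulli_weight p E \<omega> * (of_bool (?ok \<omega> \<sigma>) * ?f \<sigma>)))"
    by (intro sum.cong refl)
       (simp add: ising_weight_expansion[OF G p] sum_distrib_left sum_distrib_right mult_ac)
  also have "\<dots> = ?c * (\<Sum>\<omega>\<in>(E \<rightarrow>\<^sub>E {0, 1}). bernoulli_weight p E \<omega> *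
      (\<Sum>\<sigma>\<in>?S. of_bool (?ok \<omega> \<sigma>) * ?f \<sigma>))"
    unfolding sum_distrib_left[symmetric] by (subst sum.swap) (simp only: sum_distrib_left)
  also have "\<dots> = ?c * (\<Sum>\<omega>\<in>(E \<rightarrow>\<^sub>E {0, 1}). rc_weight \<beta> p h V E \<omega> *
      ((g 1 * exp (k \<omega>) + g (-1) * exp (- k \<omega>)) / (2 * cosh (k \<omega>))))"
  proof (intro arg_cong[where f = "(*) ?c"] sum.cong refl)
    fix \<omega>
    have "(\<Sum>\<sigma>\<in>?S. of_bool (?ok \<omega> \<sigma>) * ?f \<sigma>) = (\<Sum>\<sigma>\<in>{\<sigma> \<in> ?S. ?ok \<omega> \<sigma>}. ?f \<sigma>)"
      using fin by (intro sum.mono_neutral_cong_right) (auto intro: finite_PiE)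
    then show "bernoulli_weight p E \<omega> * (\<Sum>\<sigma>\<in>?S. of_bool (?ok \<omega> \<sigma>) * ?f \<sigma>) =
        rc_weight \<beta> p h V E \<omega> *
        ((g 1 * exp (k \<omega>) + g (-1) * exp (- k \<omega>)) / (2 * cosh (k \<omega>)))"
      by (simp only: sum_over_cluster_signs[OF fin x, where g = g] rc_weight_def k_def mult.assoc)
  qed
  finally show ?thesis .
qed

section \<open>The law of a single spin\<close>

theorem theorem3:
  fixes V :: "'v set" and E :: "'v set set" and \<beta> :: real
    and J p :: "'v set \<Rightarrow> real" and h :: "'v \<Rightarrow> real" and x :: 'v
  assumes "finite_graph V E"
    and "\<beta> > 0"
    and "\<And>e. e \<in> E \<Longrightarrow> J e \<ge> 0"
    and "\<And>e. e \<in> E \<Longrightarrow> p e = 1 - exp (- 2 * \<beta> * J e)"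
    and "x \<in> V"
  shows "\<P>(\<sigma> in ising_measure \<beta> J h V E. \<sigma> x = 1) =
           1 / 2 + 1 / 2 * (\<integral>\<omega>. tanh (cluster_field \<beta> h (cluster_of V (open_edges E \<omega>) x))
                              \<partial>rc_measure \<beta> p h V E)
       \<and> \<P>(\<sigma> in ising_measure \<beta> J h V E. \<sigma> x = -1) =
           1 / 2 - 1 / 2 * (\<integral>\<omega>. tanh (cluster_field \<beta> h (cluster_of V (open_edges E \<omega>) x))
                              \<partial>rc_measure \<beta> p h V E)"
proof -
  note G = assms(1) and p = assms(4) and x = assms(5)
  let ?S = "V \<rightarrow>\<^sub>E {-1, 1 :: real}" and ?\<Omega> = "E \<rightarrow>\<^sub>E {0, 1 :: nat}"
  let ?I = "ising_weight \<beta> J h V E" and ?R = "rc_weight \<beta> p h V E"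
  let ?c = "exp (\<beta> * (\<Sum>e\<in>E. J e))"
  let ?T = "\<lambda>\<omega>. tanh (cluster_field \<beta> h (cluster_of V (open_edges E \<omega>) x))"
  have fin: "finite V" "finite E"
    using G by (auto simp: finite_graph_def intro: finite_subset[of _ "Pow V"])
  have finS: "finite ?S" and fin\<Omega>: "finite ?\<Omega>"
    using fin by (auto intro: finite_PiE)
  have "?S \<noteq> {}"
    by (simp add: PiE_eq_empty_iff)
  then have Z_pos: "0 < (\<Sum>\<sigma>\<in>?S. ?I \<sigma>)"
    using finS by (intro sum_pos) (auto simp: ising_weight_def)
  have p01: "0 \<le> p e" "0 \<le> 1 - p e" if "e \<in> E" for e
    using assms(2) assms(3)[OF that] by (auto simp: p[OF that])
  have R_nonneg: "0 \<le> ?R \<omega>" for \<omega>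
    unfolding rc_weight_def bernoulli_weight_def using p01
    by (intro mult_nonneg_nonneg prod_nonneg) auto
  have Z: "(\<Sum>\<sigma>\<in>?S. ?I \<sigma>) = ?c * (\<Sum>\<omega>\<in>?\<Omega>. ?R \<omega>)"
    using ising_sum_eq_random_cluster_sum[OF G p x, where g = "\<lambda>_. 1" and h = h]
    by (simp add: exp_sum_eq_cosh)
  have "(\<Sum>\<sigma>\<in>?S. ?I \<sigma> * \<sigma> x) = ?c * (\<Sum>\<omega>\<in>?\<Omega>. ?R \<omega> * ?T \<omega>)"
    using ising_sum_eq_random_cluster_sum[OF G p x, where g = "\<lambda>s. s" and h = h]
    by (simp add: exp_diff_div_cosh)
  then have mean: "(\<Sum>\<sigma>\<in>?S. ?I \<sigma> * \<sigma> x) / (\<Sum>\<sigma>\<in>?S. ?I \<sigma>) = (\<integral>\<omega>. ?T \<omega> \<partial>rc_measure \<beta> p h V E)"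
    unfolding rc_measure_def integral_normalized_measure[OF fin\<Omega> R_nonneg] Z by simp
  have "\<P>(\<sigma> in ising_measure \<beta> J h V E. \<sigma> x = s) =
      1 / 2 + s / 2 * (\<integral>\<omega>. ?T \<omega> \<partial>rc_measure \<beta> p h V E)" if "s \<in> {-1, 1}" for s
    unfolding ising_measure_def mean[symmetric] using x that finS Z_pos
    by (intro prob_sign_eq_half_plus_expectation) (auto simp: ising_weight_def)
  from this[of 1] this[of "-1"] show ?thesis
    by simp
qed

end
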